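(* Let $G$ be a finite connected nonbipartite graph (loops and multiple edges allowed) that is regular of degree $q+1\geq 3$. Then there is a number $\beta\in[q^{-1/2},1)$ depending only on $G$ such that for every nonempty finite connected subgraph $X$ of the universal cover $\widetilde{G}$ there is a constant $C>0$, depending only on $G$ and $X$, such that for every function $f:V\to\mathbb{R}$ on the vertices of $G$ and every integer $r\geq 0$, $$\Big|\frac{1}{|\mathcal{T}_r(X)|}\sum_{v\in\mathcal{T}_r(X)}\tilde f(v)-\frac{1}{|V|}\sum_{v\in V}f(v)\Big|\leq C\,\|f\|_2\,\beta^r .$$
   Context: $G$ is a graph with vertex set $V$ and edge set $E$; a loop at a vertex contributes $2$ to its degree. The universal cover $\widetilde{G}$ of $G$ is the tree, with vertex set $\widetilde{V}$ and edge set $\widetilde{E}$, constructed as follows: fix a root vertex of $G$; the vertices of $\widetilde{G}$ are the non-backtracking paths in $G$ starting at the root (each edge, including each loop, may be traversed in two mutually inverse directions, and a path is non-backtracking if no step is immediately followed by its inverse); two such paths are neighbours if they differ by exactly one edge at the end. The projection $\pi:\widetilde{G}\to G$ sends a path to its terminal vertex. The lift of $f:V\to\mathbb{R}$ is $\tilde f=f\circ\pi:\widetilde{V}\to\mathbb{R}$, and $\|f\|_2=\big(\sum_{v\in V}f(v)^2\big)^{1/2}$. Let $\delta$ be the combinatorial distance on $\widetilde{G}$. For a connected subgraph $X$ of $\widetilde{G}$ with vertex set $V(X)$, the tube of radius $r$ around $X$ is $$\mathcal{T}_r(X)=\{v\in\widetilde{V}:\min_{x\in V(X)}\delta(v,x)=r\}.$$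 *)

theory Defs
  imports "HOL-Analysis.L2_Norm" "Graph_Theory.Graph_Theory"
begin

text \<open>
  An undirected graph with loops and multiple edges is a \<^locale>\<open>bidirected_digraph\<close>: every edge
  is a pair of arcs \<open>a\<close>, \<open>arev a\<close>, its two directions. Since \<open>arev\<close> has no fixed point among the
  arcs, a loop at \<open>v\<close> also consists of two arcs, so that it contributes 2 to \<open>out_degree G v\<close>.
\<close>

definition bipartite :: "('v, 'e) pre_digraph \<Rightarrow> bool" where
  "bipartite G \<longleftrightarrow> (\<exists>A B. verts G = A \<union> B \<and> A \<inter> B = {} \<and>
     (\<forall>e \<in> arcs G. tail G e \<in> A \<and> head G e \<in> B \<or> tail G e \<in> B \<and> head G e \<in> A))"

definition nonbacktracking :: "('e \<Rightarrow> 'e) \<Rightarrow> 'e list \<Rightarrow> bool" where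
  "nonbacktracking arev p \<longleftrightarrow> successively (\<lambda>a b. b \<noteq> arev a) p"

definition cover_verts :: "('v, 'e) pre_digraph \<Rightarrow> ('e \<Rightarrow> 'e) \<Rightarrow> 'v \<Rightarrow> 'e list set" where
  "cover_verts G arev v0 =
     {p. (\<exists>v. pre_digraph.awalk G v0 p v) \<and> nonbacktracking arev p}"

definition universal_cover ::
    "('v, 'e) pre_digraph \<Rightarrow> ('e \<Rightarrow> 'e) \<Rightarrow> 'v \<Rightarrow> 'e list pair_pre_digraph" where
  "universal_cover G arev v0 =
     \<lparr> pverts = cover_verts G arev v0,
       parcs = {(p, p'). p \<in> cover_verts G arev v0 \<and> p' \<in> cover_verts G arev v0 \<and>
                         (\<exists>a. p' = p @ [a] \<or> p = p' @ [a])} \<rparr>"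

definition cover_proj :: "('v, 'e) pre_digraph \<Rightarrow> 'v \<Rightarrow> 'e list \<Rightarrow> 'v" where
  "cover_proj G v0 p = pre_digraph.awlast G v0 p"

definition lift :: "('v, 'e) pre_digraph \<Rightarrow> 'v \<Rightarrow> ('v \<Rightarrow> real) \<Rightarrow> 'e list \<Rightarrow> real" where
  "lift G v0 f = f \<circ> cover_proj G v0"

text \<open>Meaningful only if \<open>v\<close> is reachable from \<open>u\<close>, which always holds in a connected graph.\<close>

definition graph_dist :: "('v, 'e) pre_digraph \<Rightarrow> 'v \<Rightarrow> 'v \<Rightarrow> nat" where
  "graph_dist T u v = (LEAST n. \<exists>p. pre_digraph.awalk T u p v \<and> length p = n)"

definition tube ::
    "('v, 'e) pre_digraph \<Rightarrow> ('v, 'e) pre_digraph \<Rightarrow> nat \<Rightarrow> 'v set" where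
  "tube T X r = {v \<in> verts T. Min ((\<lambda>x. graph_dist T v x) ` verts X) = r}"

end

theory Submission
  imports Defs "HOL-Analysis.Function_Topology" "HOL-Library.Sublist"
begin

text \<open>
  Let \<open>P\<close> average a function on the arcs of \<open>G\<close> over the \<open>q\<close> nonbacktracking successors of each
  arc. Every arc also has \<open>q\<close> predecessors, so \<open>P\<close> preserves the mean and is a contraction of
  \<open>\<ell>\<^sup>2\<close>; the norm defect of \<open>g\<close> is the sum of the variances of \<open>g\<close> over the successor sets. If
  \<open>P \<circ> P\<close> preserves the norm of \<open>g\<close>, then \<open>g\<close> and \<open>P g\<close> are therefore constant on successor
  sets. As \<open>q \<ge> 2\<close>, they only depend on the tail of an arc, \<open>g = \<phi> \<circ> tail\<close> and \<open>P g = \<psi> \<circ> tail\<close>,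
  and \<open>\<phi>\<close> at one end of an arc equals \<open>\<psi>\<close> at the other. Then \<open>\<bar>\<phi> - \<psi>\<bar>\<close> is constant and
  \<open>\<phi> - \<psi>\<close> changes sign along every arc, so \<open>\<phi> = \<psi>\<close> because \<open>G\<close> is not bipartite, and
  \<open>g\<close> is constant. By compactness \<open>P \<circ> P\<close> is a strict contraction on functions of mean 0.

  In the cover, projecting the last arc of the path from \<open>X\<close> to a point of the tube of radius
  \<open>r + 1\<close> turns averages over this tube into averages of \<open>P\<^sup>r (f \<circ> head)\<close> over the tube of radius 1,
  which yields the exponential convergence to the mean.
\<close>

section \<open>The nonbacktracking averaging operator\<close>

text \<open>The constant factor \<open>2 * c\<close> stands in front so that
  \<open>sum_distrib_left\<close> can pull it out of a sum over \<open>x\<close>.\<close>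

lemma diff_square: "(x - c)\<^sup>2 = x\<^sup>2 + c\<^sup>2 - 2 * c * x" for x c :: real
  by (simp add: power2_eq_square algebra_simps)

locale regular_bidirected_digraph = bidirected_digraph G arev + fin_digraph G
  for G :: "('v, 'e) pre_digraph" and arev :: "'e \<Rightarrow> 'e" +
  fixes q :: nat
  assumes regular: "v \<in> verts G \<Longrightarrow> out_degree G v = q + 1"
    and q_ge_2: "2 \<le> q"
begin

definition nb_succ :: "'e \<Rightarrow> 'e set" where
  "nb_succ a = {b \<in> arcs G. tail G b = head G a \<and> b \<noteq> arev a}"

definition nb_avg :: "('e \<Rightarrow> real) \<Rightarrow> 'e \<Rightarrow> real" where
  "nb_avg h a = (\<Sum>b\<in>nb_succ a. h b) / real q"

lemma finite_nb_succ [simp]: "finite (nb_succ a)"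
  by (simp add: nb_succ_def)

lemma nb_succ_subset: "nb_succ a \<subseteq> arcs G"
  by (auto simp: nb_succ_def)

lemma card_nb_succ:
  assumes "a \<in> arcs G"
  shows "card (nb_succ a) = q"
proof -
  have "nb_succ a = out_arcs G (head G a) - {arev a}"
    by (auto simp: nb_succ_def out_arcs_def)
  moreover have "arev a \<in> out_arcs G (head G a)"
    using assms by (simp add: out_arcs_def)
  ultimately show ?thesis
    using regular[of "head G a"] assms by (simp add: out_degree_def)
qed

text \<open>Nonbacktracking walks stay so under reversal. This turns counting predecessors into
  counting successors.\<close>

lemma nb_succ_arev:
  assumes "a \<in> arcs G" "b \<in> arcs G"
  shows "b \<in> nb_succ a \<longleftrightarrow> arev a \<in> nb_succ (arev b)"
  using assms by (auto simp: nb_succ_def)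

text \<open>Double counting: after exchanging the sums, \<open>h b\<close> occurs once per
  predecessor of \<open>b\<close>, and reversal matches these with the \<open>q\<close> successors
  of \<open>arev b\<close>.\<close>

lemma sum_sum_nb_succ:
  fixes h :: "'e \<Rightarrow> real"
  shows "(\<Sum>a\<in>arcs G. \<Sum>b\<in>nb_succ a. h b) = real q * (\<Sum>b\<in>arcs G. h b)"
proof -
  have card_preds: "card {a. a \<in> arcs G \<and> b \<in> nb_succ a} = q" if b: "b \<in> arcs G" for b
  proof -
    have "{a. a \<in> arcs G \<and> b \<in> nb_succ a} = arev ` nb_succ (arev b)"
    proof (intro equalityI subsetI)
      fix a assume "a \<in> {a. a \<in> arcs G \<and> b \<in> nb_succ a}"
      then have "arev a \<in> nb_succ (arev b)" using b nb_succ_arev by blast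
      then show "a \<in> arev ` nb_succ (arev b)" by (metis arev_arev imageI)
    next
      fix a assume "a \<in> arev ` nb_succ (arev b)"
      then obtain c where c: "c \<in> nb_succ (arev b)" "a = arev c" by blast
      then have "a \<in> arcs G" using nb_succ_subset[of "arev b"] by auto
      with c b show "a \<in> {a. a \<in> arcs G \<and> b \<in> nb_succ a}" using nb_succ_arev[of a b] by simp
    qed
    moreover have "inj_on arev (nb_succ (arev b))"
      by (metis arev_arev inj_onI)
    ultimately show ?thesis using card_nb_succ[of "arev b"] b by (simp add: card_image)
  qed
  have "(\<Sum>a\<in>arcs G. \<Sum>b\<in>nb_succ a. h b)
      = (\<Sum>a\<in>arcs G. \<Sum>b | b \<in> arcs G \<and> b \<in> nb_succ a. h b)"
    by (intro sum.cong refl) (auto simp: nb_succ_def)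
  also have "\<dots> = (\<Sum>b\<in>arcs G. \<Sum>a | a \<in> arcs G \<and> b \<in> nb_succ a. h b)"
    by (rule sum.swap_restrict) auto
  also have "\<dots> = (\<Sum>b\<in>arcs G. real q * h b)"
    using card_preds by (intro sum.cong refl) simp
  finally show ?thesis by (simp add: sum_distrib_left)
qed

lemma sum_nb_avg: "(\<Sum>a\<in>arcs G. nb_avg h a) = (\<Sum>a\<in>arcs G. h a)"
  using q_ge_2 by (simp add: nb_avg_def sum_sum_nb_succ flip: sum_divide_distrib)

lemma sum_nb_avg_funpow: "(\<Sum>a\<in>arcs G. (nb_avg ^^ n) h a) = (\<Sum>a\<in>arcs G. h a)"
  by (induction n) (simp_all add: sum_nb_avg)

lemma nb_avg_cong:
  "(\<And>a. a \<in> arcs G \<Longrightarrow> g a = h a) \<Longrightarrow> nb_avg g a = nb_avg h a"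
  using nb_succ_subset by (auto simp: nb_avg_def intro!: sum.cong)

lemma nb_avg_divide: "nb_avg (\<lambda>a. g a / c) = (\<lambda>a. nb_avg g a / c)"
  by (simp add: nb_avg_def fun_eq_iff flip: sum_divide_distrib)

text \<open>On each successor set the squared deviations add up to the sum of squares minus
  \<open>q\<close> times the squared mean; \<open>sum_sum_nb_succ\<close> then handles the
  squares.\<close>

lemma variance_nb_avg:
  "(\<Sum>a\<in>arcs G. \<Sum>b\<in>nb_succ a. (h b - nb_avg h a)\<^sup>2)
     = real q * ((\<Sum>a\<in>arcs G. (h a)\<^sup>2) - (\<Sum>a\<in>arcs G. (nb_avg h a)\<^sup>2))"
proof -
  have "(\<Sum>b\<in>nb_succ a. (h b - nb_avg h a)\<^sup>2)
      = (\<Sum>b\<in>nb_succ a. (h b)\<^sup>2) - real q * (nb_avg h a)\<^sup>2" if "a \<in> arcs G" for a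
  proof -
    have s: "(\<Sum>b\<in>nb_succ a. h b) = real q * nb_avg h a"
      using q_ge_2 by (simp add: nb_avg_def)
    have "(\<Sum>b\<in>nb_succ a. (h b - nb_avg h a)\<^sup>2)
        = (\<Sum>b\<in>nb_succ a. (h b)\<^sup>2) + real q * (nb_avg h a)\<^sup>2 - 2 * nb_avg h a * (\<Sum>b\<in>nb_succ a. h b)"
      using card_nb_succ[OF that]
      by (simp add: diff_square sum_subtractf sum.distrib flip: sum_distrib_left)
    then show ?thesis unfolding s by (simp add: power2_eq_square)
  qed
  then have "(\<Sum>a\<in>arcs G. \<Sum>b\<in>nb_succ a. (h b - nb_avg h a)\<^sup>2)
      = (\<Sum>a\<in>arcs G. (\<Sum>b\<in>nb_succ a. (h b)\<^sup>2) - real q * (nb_avg h a)\<^sup>2)"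
    by simp
  then show ?thesis
    by (simp add: sum_subtractf sum_sum_nb_succ right_diff_distrib flip: sum_distrib_left)
qed

lemma sum_squares_nb_avg_le: "(\<Sum>a\<in>arcs G. (nb_avg h a)\<^sup>2) \<le> (\<Sum>a\<in>arcs G. (h a)\<^sup>2)"
proof -
  have "0 \<le> (\<Sum>a\<in>arcs G. \<Sum>b\<in>nb_succ a. (h b - nb_avg h a)\<^sup>2)"
    by (intro sum_nonneg) simp
  then show ?thesis
    unfolding variance_nb_avg using q_ge_2 by (simp add: zero_le_mult_iff)
qed

section \<open>Functions whose norm is preserved\<close>

lemma eq_nb_avg_if_isometric:
  assumes "(\<Sum>a\<in>arcs G. (nb_avg h a)\<^sup>2) = (\<Sum>a\<in>arcs G. (h a)\<^sup>2)"
    and "a \<in> arcs G" "b \<in> nb_succ a"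
  shows "h b = nb_avg h a"
proof -
  have "(\<Sum>a\<in>arcs G. \<Sum>b\<in>nb_succ a. (h b - nb_avg h a)\<^sup>2) = 0"
    unfolding variance_nb_avg using assms(1) by simp
  then have "(\<Sum>b\<in>nb_succ a. (h b - nb_avg h a)\<^sup>2) = 0"
    using assms(2) by (subst (asm) sum_nonneg_eq_0_iff) (auto intro: sum_nonneg)
  then show ?thesis
    using assms(3) by (subst (asm) sum_nonneg_eq_0_iff) auto
qed

text \<open>Two arcs leaving the same vertex have a common predecessor, the reverse of a third one.\<close>

lemma eq_on_out_arcs_if_isometric:
  assumes iso: "(\<Sum>a\<in>arcs G. (nb_avg h a)\<^sup>2) = (\<Sum>a\<in>arcs G. (h a)\<^sup>2)"
    and b: "b \<in> arcs G" "b' \<in> arcs G" "tail G b = tail G b'"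
  shows "h b = h b'"
proof -
  \<comment> \<open>Here \<open>q \<ge> 2\<close> enters: out-degree at least 3 leaves an arc
    besides \<open>b\<close> and \<open>b'\<close>.\<close>
  have "card {b, b'} < card (out_arcs G (tail G b))"
    using regular[of "tail G b"] b q_ge_2 card_insert_le_m1[of 2 "{b'}" b]
    by (simp add: out_degree_def)
  then have "\<not> out_arcs G (tail G b) \<subseteq> {b, b'}"
    by (metis card_mono finite.emptyI finite_insert not_le)
  then obtain c where c: "c \<in> arcs G" "tail G c = tail G b" "c \<noteq> b" "c \<noteq> b'"
    by (auto simp: out_arcs_def)
  then have "arev c \<in> arcs G" "b \<in> nb_succ (arev c)" "b' \<in> nb_succ (arev c)"
    using b by (auto simp: nb_succ_def)
  then show ?thesis
    using eq_nb_avg_if_isometric[OF iso] by metis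
qed

text \<open>Connectedness gives a path in the symmetric closure, and the equation along an arc can
  be read in both directions.\<close>

lemma eq_if_eq_along_arcs:
  fixes \<phi> :: "'v \<Rightarrow> 'c"
  assumes "Digraph_Component.connected G"
    and "\<And>a. a \<in> arcs G \<Longrightarrow> \<phi> (tail G a) = \<phi> (head G a)"
    and "u \<in> verts G" "v \<in> verts G"
  shows "\<phi> u = \<phi> v"
proof -
  have "u \<rightarrow>\<^sup>*\<^bsub>with_proj (mk_symmetric G)\<^esub> v"
    using assms(1,3,4) by (auto simp: connected_def strongly_connected_def mk_symmetric_def)
  then have "(u, v) \<in> rtrancl_on (verts G) (parcs (mk_symmetric G))"
    by (simp add: reachable_def mk_symmetric_def)
  then show ?thesis
    by (induction rule: rtrancl_on_induct)
       (use assms(2) in \<open>auto simp: mk_symmetric_def\<close>)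
qed

text \<open>Isometry of one step only makes \<open>g\<close> a function of the tail. The second step
  does the same for \<open>nb_avg g\<close>, so that the two can be compared by reversing
  arcs.\<close>

lemma eq_0_if_nb_avg_isometric:
  assumes conn: "Digraph_Component.connected G" and nonbip: "\<not> bipartite G"
    and mean: "(\<Sum>a\<in>arcs G. g a) = 0"
    and iso: "(\<Sum>a\<in>arcs G. (nb_avg (nb_avg g) a)\<^sup>2) = (\<Sum>a\<in>arcs G. (g a)\<^sup>2)"
    and a: "a \<in> arcs G"
  shows "g a = 0"
proof -
  have iso1: "(\<Sum>a\<in>arcs G. (nb_avg g a)\<^sup>2) = (\<Sum>a\<in>arcs G. (g a)\<^sup>2)"
    and iso2: "(\<Sum>a\<in>arcs G. (nb_avg (nb_avg g) a)\<^sup>2) = (\<Sum>a\<in>arcs G. (nb_avg g a)\<^sup>2)"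
    using iso sum_squares_nb_avg_le[of g] sum_squares_nb_avg_le[of "nb_avg g"] by linarith+
  \<comment> \<open>An arbitrary arc leaving each vertex; since \<open>g\<close> and
    \<open>nb_avg g\<close> agree on all arcs leaving a vertex, the choice does not affect \<phi>
    and \<psi>.\<close>
  define out where "out v = (SOME b. b \<in> out_arcs G v)" for v
  have out: "out v \<in> arcs G \<and> tail G (out v) = v" if "v \<in> verts G" for v
  proof -
    have "out_arcs G v \<noteq> {}"
      using regular[OF that] by (auto simp: out_degree_def)
    then have "out v \<in> out_arcs G v"
      unfolding out_def some_in_eq .
    then show ?thesis by (simp add: out_arcs_def)
  qed
  define \<phi> \<psi> where "\<phi> v = g (out v)" and "\<psi> v = nb_avg g (out v)" for v
  have g_eq: "g b = \<phi> (tail G b)" and avg_eq: "nb_avg g b = \<psi> (tail G b)" if "b \<in> arcs G" for b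
    using eq_on_out_arcs_if_isometric[OF iso1 that, of "out (tail G b)"]
      eq_on_out_arcs_if_isometric[OF iso2 that, of "out (tail G b)"] out[of "tail G b"] that
    by (simp_all add: \<phi>_def \<psi>_def)
  have step: "\<psi> (tail G b) = \<phi> (head G b)" if b: "b \<in> arcs G" for b
  proof -
    have "nb_succ b \<noteq> {}"
      using card_nb_succ[OF b] q_ge_2 by auto
    then obtain c where c: "c \<in> nb_succ b" by blast
    then have "g c = nb_avg g b"
      using eq_nb_avg_if_isometric[OF iso1 b] by blast
    then show ?thesis
      using c g_eq[of c] avg_eq[OF b] by (simp add: nb_succ_def)
  qed
  have step': "\<psi> (head G b) = \<phi> (tail G b)" if "b \<in> arcs G" for b
    using step[of "arev b"] that by simp
  have eq: "\<phi> v = \<psi> v" if v: "v \<in> verts G" for v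
  proof (rule ccontr)
    assume ne: "\<phi> v \<noteq> \<psi> v"
    have abs_eq: "\<bar>\<phi> v - \<psi> v\<bar> = \<bar>\<phi> u - \<psi> u\<bar>" if "u \<in> verts G" for u
      by (rule eq_if_eq_along_arcs[OF conn _ v that]) (simp add: step step' abs_minus_commute)
    then have ne': "\<phi> u \<noteq> \<psi> u" if "u \<in> verts G" for u
      using ne abs_eq[OF that] by auto
    \<comment> \<open>The sign of \<phi> - \<psi> is a proper 2-colouring, as \<phi> and \<psi>
      exchange their values along every arc.\<close>
    define A B where "A = {u \<in> verts G. \<phi> u < \<psi> u}" and "B = {u \<in> verts G. \<psi> u < \<phi> u}"
    have "tail G b \<in> A \<and> head G b \<in> B \<or> tail G b \<in> B \<and> head G b \<in> A" if b: "b \<in> arcs G" for b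
      using step[OF b] step'[OF b] ne'[of "tail G b"] b by (simp add: A_def B_def neq_iff)
    moreover have "verts G \<subseteq> A \<union> B"
    proof
      fix u assume u: "u \<in> verts G"
      with ne'[OF u] show "u \<in> A \<union> B" by (simp add: A_def B_def neq_iff)
    qed
    moreover have "A \<union> B \<subseteq> verts G" "A \<inter> B = {}" by (auto simp: A_def B_def)
    ultimately have "bipartite G"
      unfolding bipartite_def by (intro exI[of _ A] exI[of _ B]) auto
    with nonbip show False by contradiction
  qed
  have "g b = g a" if b: "b \<in> arcs G" for b
  proof -
    have "\<phi> (tail G c) = \<phi> (head G c)" if "c \<in> arcs G" for c
      using step[OF that] eq[of "tail G c"] that by simp
    then have "\<phi> (tail G b) = \<phi> (tail G a)"
      by (rule eq_if_eq_along_arcs[OF conn]) (use a b in auto)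
    then show ?thesis using g_eq a b by simp
  qed
  then have "(\<Sum>b\<in>arcs G. g b) = real (card (arcs G)) * g a"
    by simp
  then show ?thesis
    using mean a by (auto simp: card_eq_0_iff)
qed

section \<open>Strict contraction and decay on functions of mean 0\<close>

lemma nb_avg_contraction:
  assumes conn: "Digraph_Component.connected G" and nonbip: "\<not> bipartite G"
  obtains \<rho> where "0 \<le> \<rho>" "\<rho> < 1"
    "\<And>g. (\<Sum>a\<in>arcs G. g a) = 0 \<Longrightarrow>
       (\<Sum>a\<in>arcs G. (nb_avg (nb_avg g) a)\<^sup>2) \<le> \<rho> * (\<Sum>a\<in>arcs G. (g a)\<^sup>2)"
proof -
  define N :: "('e \<Rightarrow> real) \<Rightarrow> real" where "N g = (\<Sum>a\<in>arcs G. (g a)\<^sup>2)" for g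
  define E where "E g = N (nb_avg (nb_avg g))" for g
  \<comment> \<open>The type \<open>'e\<close> may be infinite, so functions are fixed to be 0 off
    the arcs. The cube makes Tychonoff applicable and contains every such function of norm
    1.\<close>
  define S :: "('e \<Rightarrow> real) set" where
    "S = (\<Pi>\<^sub>E a\<in>UNIV. if a \<in> arcs G then {-1..1} else {0})
         \<inter> {g. (\<Sum>a\<in>arcs G. g a) = 0} \<inter> {g. N g = 1}"
  have cont_N: "continuous_on UNIV N"
    unfolding N_def by (intro continuous_intros) auto
  have cont_E: "continuous_on UNIV E"
    unfolding E_def N_def nb_avg_def using q_ge_2 by (intro continuous_intros) auto
  have "compactin (product_topology (\<lambda>_::'e. euclidean :: real topology) UNIV)
     (\<Pi>\<^sub>E a\<in>UNIV. if a \<in> arcs G then {-1..1} else {0})"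
    by (auto simp: compactin_PiE)
  then have "compact (\<Pi>\<^sub>E a\<in>(UNIV :: 'e set). if a \<in> arcs G then {-1..1::real} else {0})"
    by (simp add: euclidean_product_topology)
  moreover have "closed {g :: 'e \<Rightarrow> real. (\<Sum>a\<in>arcs G. g a) = 0}"
    by (intro closed_Collect_eq continuous_intros) auto
  moreover have "closed {g. N g = 1}"
    by (intro closed_Collect_eq cont_N continuous_intros)
  ultimately have "compact S"
    unfolding S_def by (intro compact_Int_closed)
  have E_less: "E g < 1" if g: "g \<in> S" for g
  proof -
    have "E g \<le> N g"
      unfolding E_def N_def
      using sum_squares_nb_avg_le[of g] sum_squares_nb_avg_le[of "nb_avg g"] by linarith
    moreover have "E g \<noteq> N g"
    proof
      assume "E g = N g"
      then have "g a = 0" if "a \<in> arcs G" for a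
        using eq_0_if_nb_avg_isometric[OF conn nonbip _ _ that, of g] g
        by (simp add: S_def E_def N_def)
      then have "N g = 0" by (simp add: N_def)
      with g show False by (simp add: S_def)
    qed
    ultimately show ?thesis using g by (simp add: S_def)
  qed
  \<comment> \<open>\<rho> is the maximum of \<open>E\<close> on the compact set \<open>S\<close>,
    or 0 if \<open>S\<close> is empty.\<close>
  obtain \<rho> where \<rho>: "0 \<le> \<rho>" "\<rho> < 1" "\<And>g. g \<in> S \<Longrightarrow> E g \<le> \<rho>"
  proof (cases "S = {}")
    case True
    then show ?thesis using that[of 0] by simp
  next
    case False
    then obtain g where "g \<in> S" "\<forall>h\<in>S. E h \<le> E g"
      using continuous_attains_sup[OF \<open>compact S\<close> False continuous_on_subset[OF cont_E]] by auto
    moreover have "0 \<le> E g"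
      unfolding E_def N_def by (intro sum_nonneg) simp
    ultimately show ?thesis using that[of "E g"] E_less by blast
  qed
  have "E g \<le> \<rho> * N g" if mean: "(\<Sum>a\<in>arcs G. g a) = 0" for g
  proof (cases "N g = 0")
    case True
    then show ?thesis
      using sum_squares_nb_avg_le[of g] sum_squares_nb_avg_le[of "nb_avg g"]
      by (simp add: E_def N_def)
  next
    case False
    have "0 \<le> N g" by (simp add: N_def sum_nonneg)
    with False have pos: "0 < N g" by simp
    define s where "s = sqrt (N g)"
    have s: "0 < s" "s\<^sup>2 = N g" using pos by (simp_all add: s_def)
    \<comment> \<open>Rescaling to norm 1 and cutting off outside the arcs puts \<open>g\<close>
      into \<open>S\<close>; \<open>nb_avg\<close> does not see the cut-off.\<close>
    define h where "h a = (if a \<in> arcs G then g a / s else 0)" for a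
    have "h \<in> S"
    proof -
      have "N h = (\<Sum>a\<in>arcs G. (g a)\<^sup>2) / s\<^sup>2"
        by (simp add: N_def h_def power_divide flip: sum_divide_distrib)
      then have "N h = 1"
        using s pos by (simp add: N_def)
      have "(\<Sum>a\<in>arcs G. h a) = 0"
        using mean by (simp add: h_def flip: sum_divide_distrib)
      moreover have "h a \<in> {-1..1}" if "a \<in> arcs G" for a
      proof -
        have "(h a)\<^sup>2 \<le> N h"
          unfolding N_def using that by (intro member_le_sum) auto
        then show ?thesis
          using \<open>N h = 1\<close> abs_le_square_iff[of "h a" 1] by (simp add: abs_le_iff)
      qed
      moreover have "h a = 0" if "a \<notin> arcs G" for a
        using that by (simp add: h_def)
      ultimately show ?thesis
        using \<open>N h = 1\<close> by (auto simp: S_def PiE_def Pi_def)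
    qed
    have "nb_avg h = (\<lambda>a. nb_avg g a / s)"
      unfolding nb_avg_divide[symmetric] by (intro ext nb_avg_cong) (simp add: h_def)
    then have "E h = E g / s\<^sup>2"
      by (simp add: E_def N_def nb_avg_divide power_divide flip: sum_divide_distrib)
    then show ?thesis
      using \<rho>(3)[OF \<open>h \<in> S\<close>] s pos by (simp add: divide_le_eq)
  qed
  then show ?thesis using that \<rho>(1,2) by (auto simp: E_def N_def)
qed

text \<open>Pairs of applications contract, and a value at an arc is at most the norm. The factor
  \<beta> on the left pays for the application left over when \<open>n\<close> is odd.\<close>

lemma nb_avg_decay:
  assumes "Digraph_Component.connected G" "\<not> bipartite G"
  obtains \<beta> where "real q powr (-1/2) \<le> \<beta>" "\<beta> < 1"
    "\<And>g n a. (\<Sum>a\<in>arcs G. g a) = 0 \<Longrightarrow> a \<in> arcs G \<Longrightarrow>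
       \<beta> * \<bar>(nb_avg ^^ n) g a\<bar> \<le> L2_set g (arcs G) * \<beta> ^ n"
proof -
  obtain \<rho> where \<rho>: "0 \<le> \<rho>" "\<rho> < 1"
    "\<And>g. (\<Sum>a\<in>arcs G. g a) = 0 \<Longrightarrow>
       (\<Sum>a\<in>arcs G. (nb_avg (nb_avg g) a)\<^sup>2) \<le> \<rho> * (\<Sum>a\<in>arcs G. (g a)\<^sup>2)"
    using nb_avg_contraction[OF assms] by blast
  \<comment> \<open>A fourth root, since two applications shrink the squared norm by \<rho>. The
    maximum ensures the required lower bound and makes \<beta> positive even if \<rho> is 0.\<close>
  define \<beta> where "\<beta> = max (root 4 \<rho>) (real q powr (-1/2))"
  have q1: "real q powr (-1/2) < 1" "0 < real q powr (-1/2)"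
    using q_ge_2 by (auto intro!: powr_less_one)
  then have \<beta>: "real q powr (-1/2) \<le> \<beta>" "\<beta> < 1" "0 < \<beta>"
    using \<rho> by (auto simp: \<beta>_def less_max_iff_disj)
  have "root 4 \<rho> ^ 4 \<le> \<beta> ^ 4"
    by (rule power_mono) (use \<rho> in \<open>auto simp: \<beta>_def\<close>)
  then have \<rho>\<beta>: "\<rho> \<le> \<beta> ^ 4" using \<rho> by simp
  have even: "(\<Sum>a\<in>arcs G. ((nb_avg ^^ (2 * k)) g a)\<^sup>2) \<le> \<beta> ^ (4 * k) * (\<Sum>a\<in>arcs G. (g a)\<^sup>2)"
    if mean: "(\<Sum>a\<in>arcs G. g a) = 0" for g k
  proof (induction k)
    case (Suc k)
    let ?h = "(nb_avg ^^ (2 * k)) g"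
    have "(\<Sum>a\<in>arcs G. ((nb_avg ^^ (2 * Suc k)) g a)\<^sup>2) \<le> \<rho> * (\<Sum>a\<in>arcs G. (?h a)\<^sup>2)"
      using \<rho>(3)[of ?h] mean by (simp add: sum_nb_avg_funpow)
    also have "\<dots> \<le> \<beta> ^ 4 * (\<beta> ^ (4 * k) * (\<Sum>a\<in>arcs G. (g a)\<^sup>2))"
      using Suc \<rho>\<beta> \<beta> by (intro mult_mono) (auto intro: sum_nonneg)
    finally show ?case by (simp add: power_add mult_ac)
  qed simp
  have "\<beta> * \<bar>(nb_avg ^^ n) g a\<bar> \<le> L2_set g (arcs G) * \<beta> ^ n"
    if mean: "(\<Sum>a\<in>arcs G. g a) = 0" and a: "a \<in> arcs G" for g n a
  proof -
    have "((nb_avg ^^ n) g a)\<^sup>2 \<le> (\<Sum>a\<in>arcs G. ((nb_avg ^^ n) g a)\<^sup>2)"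
      using a by (intro member_le_sum) auto
    also have "\<dots> \<le> (\<Sum>a\<in>arcs G. ((nb_avg ^^ (2 * (n div 2))) g a)\<^sup>2)"
      using sum_squares_nb_avg_le[of "(nb_avg ^^ (2 * (n div 2))) g"]
      by (cases "even n") (auto elim!: oddE)
    also have "\<dots> \<le> \<beta> ^ (4 * (n div 2)) * (\<Sum>a\<in>arcs G. (g a)\<^sup>2)"
      by (rule even[OF mean])
    finally have "(\<beta> * (nb_avg ^^ n) g a)\<^sup>2 \<le> \<beta> ^ (2 + 4 * (n div 2)) * (\<Sum>a\<in>arcs G. (g a)\<^sup>2)"
      using \<beta>(3) unfolding power_mult_distrib power_add mult.assoc by (intro mult_left_mono) simp_all
    \<comment> \<open>Uses \<open>n \<le> 2 * (n div 2) + 1\<close> and \<beta> < 1.\<close>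
    also have "\<dots> \<le> \<beta> ^ (2 * n) * (\<Sum>a\<in>arcs G. (g a)\<^sup>2)"
      using \<beta> by (intro mult_right_mono power_decreasing) (auto intro: sum_nonneg)
    also have "\<dots> = (L2_set g (arcs G) * \<beta> ^ n)\<^sup>2"
      by (simp add: L2_set_def power_mult_distrib sum_nonneg power_mult[symmetric] mult.commute)
    finally have "\<bar>\<beta> * (nb_avg ^^ n) g a\<bar> \<le> \<bar>L2_set g (arcs G) * \<beta> ^ n\<bar>"
      by (simp only: abs_le_square_iff)
    then show ?thesis
      using \<beta> by (simp add: abs_mult)
  qed
  with \<beta> show ?thesis using that by blast
qed

section \<open>From functions on vertices to functions on arcs\<close>

lemma sum_head_arcs:
  fixes h :: "'v \<Rightarrow> real"
  shows "(\<Sum>a\<in>arcs G. h (head G a)) = real (q + 1) * (\<Sum>v\<in>verts G. h v)"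
proof -
  have "(\<Sum>a\<in>arcs G. h (head G a)) = (\<Sum>a\<in>arcs G. h (tail G a))"
    by (subst sum.permute[OF arev_permutes_arcs]) simp
  also have "\<dots> = (\<Sum>v\<in>verts G. \<Sum>a | a \<in> arcs G \<and> tail G a = v. h (tail G a))"
    by (rule sum.group[symmetric]) auto
  also have "\<dots> = (\<Sum>v\<in>verts G. real (q + 1) * h v)"
  proof (rule sum.cong[OF refl])
    fix v assume "v \<in> verts G"
    then have "card {a \<in> arcs G. tail G a = v} = q + 1"
      using regular[of v] by (simp add: out_degree_def out_arcs_def)
    then show "(\<Sum>a | a \<in> arcs G \<and> tail G a = v. h (tail G a)) = real (q + 1) * h v"
      by simp
  qed
  finally show ?thesis by (simp add: sum_distrib_left)
qed

lemma sum_head_arcs_mean_0: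
  fixes f :: "'v \<Rightarrow> real"
  assumes "verts G \<noteq> {}"
  shows "(\<Sum>a\<in>arcs G. f (head G a) - (\<Sum>v\<in>verts G. f v) / card (verts G)) = 0"
  unfolding sum_head_arcs[of "\<lambda>v. f v - (\<Sum>v\<in>verts G. f v) / card (verts G)"]
  using assms by (simp add: sum_subtractf)

text \<open>Subtracting the mean does not increase the sum of squares, and composing with the head
  map multiplies it by \<open>q + 1\<close>.\<close>

lemma L2_set_head_arcs_le:
  fixes f :: "'v \<Rightarrow> real"
  assumes "verts G \<noteq> {}"
  shows "L2_set (\<lambda>a. f (head G a) - (\<Sum>v\<in>verts G. f v) / card (verts G)) (arcs G)
    \<le> sqrt (q + 1) * L2_set f (verts G)"
proof -
  define m where "m = (\<Sum>v\<in>verts G. f v) / card (verts G)"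
  have sm: "(\<Sum>v\<in>verts G. f v) = card (verts G) * m"
    using assms by (simp add: m_def)
  have "(\<Sum>v\<in>verts G. (f v - m)\<^sup>2)
      = (\<Sum>v\<in>verts G. (f v)\<^sup>2) + card (verts G) * m\<^sup>2 - 2 * m * (\<Sum>v\<in>verts G. f v)"
    by (simp add: diff_square sum_subtractf sum.distrib flip: sum_distrib_left)
  also have "\<dots> = (\<Sum>v\<in>verts G. (f v)\<^sup>2) - card (verts G) * m\<^sup>2"
    unfolding sm by (simp add: power2_eq_square)
  finally have "(\<Sum>a\<in>arcs G. (f (head G a) - m)\<^sup>2) \<le> (q + 1) * (\<Sum>v\<in>verts G. (f v)\<^sup>2)"
    unfolding sum_head_arcs[of "\<lambda>v. (f v - m)\<^sup>2"] by (intro mult_left_mono) simp_all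
  then show ?thesis
    unfolding L2_set_def m_def[symmetric] by (metis real_sqrt_le_mono real_sqrt_mult)
qed

end

section \<open>Tubes in the universal cover\<close>

text \<open>In a subtree \<open>X\<close> of the cover, \<open>p0\<close> is the vertex nearest to the root. The root need
  not belong to \<open>X\<close>: the strict prefixes of \<open>p0\<close> are joined to \<open>X\<close> by descending to \<open>p0\<close>, all other
  vertices by ascending.\<close>

locale cover_subtree = regular_bidirected_digraph G arev q
  for G :: "('v, 'e) pre_digraph" and arev :: "'e \<Rightarrow> 'e" and q :: nat +
  fixes v0 :: 'v and X :: "'e list set" and p0 :: "'e list"
  assumes v0: "v0 \<in> verts G"
    and X_subset: "X \<subseteq> cover_verts G arev v0"
    and finite_X: "finite X"
    and p0: "p0 \<in> X"
    and prefix_p0: "x \<in> X \<Longrightarrow> prefix p0 x"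
    and X_closed: "x \<in> X \<Longrightarrow> prefix p0 y \<Longrightarrow> prefix y x \<Longrightarrow> y \<in> X"
begin

abbreviation "W \<equiv> cover_verts G arev v0"
abbreviation "proj \<equiv> cover_proj G v0"

lemma proj_Nil [simp]: "proj [] = v0"
  by (simp add: cover_proj_def)

lemma proj_snoc [simp]: "proj (p @ [a]) = head G a"
  by (simp add: cover_proj_def awalk_verts_conv)

lemma Nil_in_W [simp]: "[] \<in> W"
  using v0 by (auto simp: cover_verts_def nonbacktracking_def awalk_Nil_iff)

lemma in_W_iff:
  "p \<in> W \<longleftrightarrow> set p \<subseteq> arcs G \<and> cas v0 p (proj p) \<and> nonbacktracking arev p"
  using v0 awlast_if_cas[of v0 p] by (auto simp: cover_verts_def cover_proj_def awalk_def)

text \<open>The one-step description of the cover on which the later arguments rest. The guard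
  \<open>p \<noteq> []\<close> is there because \<open>last []\<close> is unspecified.\<close>

lemma snoc_in_W_iff:
  "p @ [a] \<in> W \<longleftrightarrow>
     p \<in> W \<and> a \<in> arcs G \<and> tail G a = proj p \<and> (p \<noteq> [] \<longrightarrow> a \<noteq> arev (last p))"
  by (auto simp: in_W_iff nonbacktracking_def successively_append_iff cas_append_iff cover_proj_def
      awalk_verts_conv)

lemma W_prefix_closed: "p @ p' \<in> W \<Longrightarrow> p \<in> W"
  by (induction p' rule: rev_induct) (simp_all add: snoc_in_W_iff flip: append_assoc)

lemma proj_in_verts: "p \<in> W \<Longrightarrow> proj p \<in> verts G"
  by (cases p rule: rev_cases) (simp_all add: v0 snoc_in_W_iff)

text \<open>\<open>toward v\<close> is the neighbour of \<open>v \<notin> X\<close> in the direction of \<open>X\<close>, and \<open>arc_in v\<close> is the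
  projection of the arc from \<open>toward v\<close> to \<open>v\<close>. Below, \<open>depth v\<close> is the distance from \<open>v\<close> to
  \<open>X\<close>, so \<open>level r\<close> is the tube of radius \<open>r\<close>.\<close>

definition toward :: "'e list \<Rightarrow> 'e list" where
  "toward v = (if strict_prefix v p0 then v @ [p0 ! length v] else butlast v)"

definition arc_in :: "'e list \<Rightarrow> 'e" where
  "arc_in v = (if strict_prefix v p0 then arev (p0 ! length v) else last v)"

function depth :: "'e list \<Rightarrow> nat" where
  "depth v = (if v \<in> X then 0 else if strict_prefix v p0 then length p0 - length v
     else if v = [] then 0 else Suc (depth (butlast v)))"
  by auto
termination by (relation "measure length") auto

declare depth.simps [simp del]

section \<open>Depth and the direction toward \<open>X\<close>\<close>

lemma not_strict_prefix_p0: "x \<in> X \<Longrightarrow> \<not> strict_prefix x p0"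
  using prefix_p0 prefix_order.less_le_not_le by blast

lemma strict_prefix_p0E:
  assumes "strict_prefix v p0"
  obtains c ys where "p0 = v @ c # ys" "p0 ! length v = c"
  using assms by (auto elim!: strict_prefixE')

text \<open>Here \<open>p0\<close> is the root itself. Hence the default value 0 of
  \<open>depth\<close> at \<open>[]\<close> cannot be given to a vertex outside
  \<open>X\<close>.\<close>

lemma Nil_in_X: "\<not> strict_prefix [] p0 \<Longrightarrow> [] \<in> X"
  using p0 by (cases p0) auto

lemma depth_eq_0_iff: "depth v = 0 \<longleftrightarrow> v \<in> X"
  using Nil_in_X by (subst depth.simps) (auto dest: prefix_length_less)

lemma depth_strict_prefix: "strict_prefix v p0 \<Longrightarrow> depth v = length p0 - length v"
  using not_strict_prefix_p0 by (subst depth.simps) auto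

lemma depth_prefix_snoc:
  assumes "prefix (v @ [a]) p0"
  shows "depth v = Suc (depth (v @ [a]))"
proof -
  have "strict_prefix v p0"
    using assms by (auto simp: prefix_def strict_prefix_def)
  moreover have "length v < length p0"
    using assms prefix_length_le by fastforce
  ultimately show ?thesis
    using assms p0 depth_strict_prefix[of v] depth_strict_prefix[of "v @ [a]"]
      depth_eq_0_iff[of p0]
    by (cases "v @ [a] = p0") (auto simp: strict_prefix_def)
qed

text \<open>\<open>p0\<close> is a proper prefix of \<open>v @ [a]\<close>, hence a prefix of
  \<open>v\<close>, and \<open>X\<close> contains all paths between \<open>p0\<close> and its
  members.\<close>

lemma butlast_in_X:
  assumes "v @ [a] \<in> X" "\<not> prefix (v @ [a]) p0"
  shows "v \<in> X"
  using prefix_p0[OF assms(1)] assms X_closed[OF assms(1), of v] by auto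

lemma depth_snoc:
  assumes "v @ [a] \<notin> X" "\<not> prefix (v @ [a]) p0"
  shows "depth (v @ [a]) = Suc (depth v)"
  using assms by (subst depth.simps) (auto simp: strict_prefix_def)

text \<open>Neighbours in the cover differ by one final arc, so a walk of length n changes the depth
  by at most n.\<close>

lemma depth_lipschitz: "depth v \<le> Suc (depth (v @ [a])) \<and> depth (v @ [a]) \<le> Suc (depth v)"
proof -
  consider "prefix (v @ [a]) p0" | "v @ [a] \<in> X" "\<not> prefix (v @ [a]) p0"
    | "v @ [a] \<notin> X" "\<not> prefix (v @ [a]) p0"
    by blast
  then show ?thesis
  proof cases
    case 1
    then show ?thesis using depth_prefix_snoc by simp
  next
    case 2
    then have "depth v = 0" "depth (v @ [a]) = 0"
      using butlast_in_X unfolding depth_eq_0_iff by blast+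
    then show ?thesis by simp
  next
    case 3
    then show ?thesis using depth_snoc by simp
  qed
qed

text \<open>A vertex outside \<open>X\<close> is strictly above \<open>p0\<close> on the path from
  the root, or it is no prefix of \<open>p0\<close>. In the second case its last arc points away
  from \<open>X\<close>.\<close>

lemma outside_cases:
  assumes "v \<in> W" "v \<notin> X"
  obtains (above) c ys where "strict_prefix v p0" "p0 = v @ c # ys" "p0 ! length v = c"
      "v @ [c] \<in> W" "toward v = v @ [c]" "arc_in v = arev c"
    | (off) u a where "\<not> prefix v p0" "v = u @ [a]" "u @ [a] \<in> W" "toward v = u" "arc_in v = a"
proof (cases "strict_prefix v p0")
  case True
  then obtain c ys where c: "p0 = v @ c # ys" "p0 ! length v = c"
    by (rule strict_prefix_p0E)
  then have "(v @ [c]) @ ys \<in> W" using p0 X_subset by auto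
  then have "v @ [c] \<in> W" by (rule W_prefix_closed)
  moreover have "toward v = v @ [c]" "arc_in v = arev c"
    unfolding toward_def arc_in_def using True c(2) by simp_all
  ultimately show ?thesis
    using True c by (intro above)
next
  case False
  then have "v \<noteq> []" using Nil_in_X assms by blast
  then obtain u a where "v = u @ [a]" by (metis rev_exhaust)
  moreover have "\<not> prefix v p0" using False p0 assms by (auto simp: strict_prefix_def)
  ultimately show ?thesis
    using False assms by (intro off) (simp_all add: toward_def arc_in_def)
qed

lemma depth_toward:
  assumes "v \<in> W" "v \<notin> X"
  shows "depth v = Suc (depth (toward v))"
  using assms
proof (cases rule: outside_cases)
  case (above c ys)
  then show ?thesis using depth_prefix_snoc[of v c] by simp
next
  case (off u a)
  then show ?thesis using depth_snoc[of u a] assms by simp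
qed

lemma toward_in_W: "v \<in> W \<Longrightarrow> v \<notin> X \<Longrightarrow> toward v \<in> W"
  by (cases v rule: outside_cases) (auto simp: snoc_in_W_iff)

lemma arc_in:
  assumes "v \<in> W" "v \<notin> X"
  shows "arc_in v \<in> arcs G" "head G (arc_in v) = proj v"
proof -
  have "arc_in v \<in> arcs G \<and> head G (arc_in v) = proj v"
    using assms by (cases rule: outside_cases) (simp_all add: snoc_in_W_iff)
  then show "arc_in v \<in> arcs G" "head G (arc_in v) = proj v" by simp_all
qed

text \<open>The vertices \<open>u\<close> are the neighbours of \<open>v\<close> other than
  \<open>toward v\<close>; they correspond to the arcs leaving \<open>proj v\<close> other than the
  reverse of \<open>arc_in v\<close>. So away from \<open>X\<close> the cover branches like
  nonbacktracking walks in \<open>G\<close>, wherever the root lies.\<close>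

lemma bij_betw_arc_in:
  assumes v: "v \<in> W" "v \<notin> X"
  shows "bij_betw arc_in {u \<in> W. u \<notin> X \<and> toward u = v} (nb_succ (arc_in v))"
proof -
  \<comment> \<open>The inverse map: follow \<open>b\<close> from \<open>v\<close> in the cover. If
    \<open>b\<close> reverses the last arc of \<open>v\<close>, the path shrinks instead of
    growing.\<close>
  define extend where
    "extend b = (if v \<noteq> [] \<and> b = arev (last v) then butlast v else v @ [b])" for b
  have "arc_in u \<in> nb_succ (arc_in v) \<and> extend (arc_in u) = u"
    if u: "u \<in> W" "u \<notin> X" and uv: "toward u = v" for u
    using u
  proof (cases rule: outside_cases)
    case u_above: (above c ys)
    \<comment> \<open>Here \<open>v\<close> is again a prefix of \<open>p0\<close>; being outside
      \<open>X\<close>, it is strictly above \<open>p0\<close>, and both incoming arcs are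
      reversed.\<close>
    have "v = u @ [c]" using u_above uv by simp
    from v show ?thesis
    proof (cases rule: outside_cases)
      case (above d zs)
      have "c \<in> arcs G" using u_above snoc_in_W_iff[of u c] by simp
      moreover have "d \<in> arcs G" "tail G d = head G c" "d \<noteq> arev c"
        using above(4) \<open>v = u @ [c]\<close> snoc_in_W_iff[of v d] by simp_all
      ultimately have "arev c \<in> nb_succ (arev d)"
        by (auto simp: nb_succ_def)
      moreover have "extend (arev c) = u" using \<open>v = u @ [c]\<close> by (simp add: extend_def)
      ultimately show ?thesis
        unfolding u_above(6) above(6) by simp
    next
      case off
      then show ?thesis using u_above \<open>v = u @ [c]\<close> by auto
    qed
  next
    case u_off: (off w a)
    have u_eq: "u = v @ [a]" using u_off uv by simp
    have a: "a \<in> arcs G" "tail G a = proj v" "v \<noteq> [] \<Longrightarrow> a \<noteq> arev (last v)"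
      using u(1) snoc_in_W_iff[of v a] unfolding u_eq by simp_all
    have "a \<in> nb_succ (arc_in v)"
      using v
    proof (cases rule: outside_cases)
      case (above d zs)
      then have "d \<in> arcs G" "tail G d = proj v" using snoc_in_W_iff[of v d] by simp_all
      \<comment> \<open>The arc excluded after \<open>arec d\<close> would be read backwards:
        \<open>arc_in v\<close> is \<open>arev d\<close>, so the excluded successor is
        \<open>d\<close>, the arc on the way to \<open>p0\<close>.\<close>
      moreover have "a \<noteq> d" using u_off(1) above(2) unfolding u_eq by auto
      ultimately show ?thesis
        unfolding above(6) using a by (simp add: nb_succ_def)
    next
      case (off x b)
      then have "proj v = head G b" "a \<noteq> arev b" using a(3) by simp_all
      then show ?thesis
        unfolding off(5) using a by (simp add: nb_succ_def)
    qed
    moreover have "extend a = u" using a(3) u_eq by (auto simp: extend_def)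
    ultimately show ?thesis unfolding u_off(5) by simp
  qed
  moreover have "extend b \<in> W \<and> extend b \<notin> X \<and> toward (extend b) = v \<and> arc_in (extend b) = b"
    if b: "b \<in> nb_succ (arc_in v)" for b
    using v
  proof (cases rule: outside_cases)
    case (above c ys)
    have bc: "b \<in> arcs G" "tail G b = tail G c" "b \<noteq> c" "c \<in> arcs G" "tail G c = proj v"
      using b above by (auto simp: nb_succ_def snoc_in_W_iff)
    show ?thesis
    proof (cases "v \<noteq> [] \<and> b = arev (last v)")
      case True
      \<comment> \<open>The arc leads back toward the root: the neighbour is the parent of
        \<open>v\<close>, also strictly above \<open>p0\<close>.\<close>
      then obtain u l where u: "v = u @ [l]" by (metis rev_exhaust)
      have bl: "b = arev l" and "extend b = u" using True u by (auto simp: extend_def)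
      have "p0 = u @ l # c # ys" using above u by simp
      then have "strict_prefix u p0" "p0 ! length u = l"
        by (auto simp: strict_prefix_def)
      moreover from this have "u \<notin> X" using not_strict_prefix_p0 by blast
      moreover have "u \<in> W" using u v snoc_in_W_iff[of u l] by simp
      ultimately have "u \<in> W \<and> u \<notin> X \<and> toward u = v \<and> arc_in u = b"
        unfolding bl u by (simp add: toward_def arc_in_def)
      then show ?thesis unfolding \<open>extend b = u\<close> .
    next
      case False
      \<comment> \<open>The arc branches off the way to \<open>p0\<close>, so the new vertex does
        not extend \<open>p0\<close> and lies outside \<open>X\<close>.\<close>
      have "v @ [b] \<in> W" using False bc v by (auto simp: snoc_in_W_iff)
      moreover have "\<not> prefix (v @ [b]) p0" "\<not> prefix p0 (v @ [b])" using above bc by auto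
      ultimately show ?thesis
        using False prefix_p0[of "v @ [b]"]
        by (auto simp: extend_def toward_def arc_in_def strict_prefix_def)
    qed
  next
    case (off u a)
    have b': "b \<in> arcs G" "tail G b = head G a" "b \<noteq> arev a"
      using b off by (auto simp: nb_succ_def)
    have "proj v = head G a" "last v = a" using off by simp_all
    then have "v @ [b] \<in> W" using v b' unfolding snoc_in_W_iff by simp
    moreover have "\<not> prefix (v @ [b]) p0"
      using off by (meson append_prefixD)
    moreover from this have "v @ [b] \<notin> X"
      using butlast_in_X v by blast
    moreover have "extend b = v @ [b]" using b' \<open>last v = a\<close> by (simp add: extend_def)
    ultimately show ?thesis
      by (simp add: toward_def arc_in_def strict_prefix_def)
  qed
  ultimately show ?thesis
    by (intro bij_betw_byWitness[where f' = extend]) auto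
qed

section \<open>Sums over levels and their sizes\<close>

definition level :: "nat \<Rightarrow> 'e list set" where
  "level n = {v \<in> W. depth v = n}"

lemma level_0: "level 0 = X"
  using X_subset by (auto simp: level_def depth_eq_0_iff)

lemma level_Suc_outside: "v \<in> level (Suc n) \<Longrightarrow> v \<in> W \<and> v \<notin> X"
  by (auto simp: level_def simp flip: depth_eq_0_iff)

lemma toward_level: "toward ` level (Suc n) \<subseteq> level n"
proof
  fix v assume "v \<in> toward ` level (Suc n)"
  then obtain u where u: "u \<in> level (Suc n)" "v = toward u" by blast
  with level_Suc_outside[OF u(1)] depth_toward[of u] toward_in_W[of u]
  show "v \<in> level n" by (simp add: level_def)
qed

text \<open>A vertex \<open>u\<close> of the next level is the parent of \<open>toward u\<close> or
  extends it by one of finitely many arcs.\<close>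

lemma finite_level: "finite (level n)"
proof (induction n)
  case 0
  show ?case by (simp add: level_0 finite_X)
next
  case (Suc n)
  have "level (Suc n) \<subseteq> (\<Union>v\<in>level n. insert (butlast v) ((\<lambda>a. v @ [a]) ` arcs G))"
  proof
    fix u assume u: "u \<in> level (Suc n)"
    then have "toward u \<in> level n" using toward_level by blast
    moreover have "u \<in> W" "u \<notin> X" using level_Suc_outside[OF u] by simp_all
    then have "u \<in> insert (butlast (toward u)) ((\<lambda>a. toward u @ [a]) ` arcs G)"
    proof (cases rule: outside_cases)
      case (above c ys)
      then show ?thesis by simp
    next
      case (off w a)
      then have "u = toward u @ [a]" "a \<in> arcs G" using snoc_in_W_iff[of w a] by simp_all
      then show ?thesis by blast
    qed
    ultimately show "u \<in> (\<Union>v\<in>level n. insert (butlast v) ((\<lambda>a. v @ [a]) ` arcs G))"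
      by blast
  qed
  then show ?case
    by (rule finite_subset) (use Suc in auto)
qed

text \<open>Group the outer level by \<open>toward\<close> and apply \<open>bij_betw_arc_in\<close>.
  The levels start at 1 because \<open>arc_in\<close> describes vertices outside
  \<open>X\<close>.\<close>

lemma sum_level_Suc_Suc:
  fixes h :: "'e \<Rightarrow> real"
  shows "(\<Sum>u\<in>level (Suc (Suc n)). h (arc_in u))
    = (\<Sum>v\<in>level (Suc n). \<Sum>b\<in>nb_succ (arc_in v). h b)"
proof -
  have "(\<Sum>u\<in>level (Suc (Suc n)). h (arc_in u))
      = (\<Sum>v\<in>level (Suc n). \<Sum>u | u \<in> level (Suc (Suc n)) \<and> toward u = v. h (arc_in u))"
    using toward_level by (intro sum.group[symmetric] finite_level)
  also have "\<dots> = (\<Sum>v\<in>level (Suc n). \<Sum>b\<in>nb_succ (arc_in v). h b)"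
  proof (rule sum.cong[OF refl])
    fix v assume v: "v \<in> level (Suc n)"
    have "u \<in> level (Suc (Suc n)) \<longleftrightarrow> u \<in> W \<and> u \<notin> X" if "toward u = v" for u
      using v that depth_toward[of u] depth_eq_0_iff[of u] by (auto simp: level_def)
    then have "{u. u \<in> level (Suc (Suc n)) \<and> toward u = v} = {u \<in> W. u \<notin> X \<and> toward u = v}"
      by auto
    then show "(\<Sum>u | u \<in> level (Suc (Suc n)) \<and> toward u = v. h (arc_in u))
        = (\<Sum>b\<in>nb_succ (arc_in v). h b)"
      using level_Suc_outside[OF v] by (simp add: sum.reindex_bij_betw[OF bij_betw_arc_in])
  qed
  finally show ?thesis .
qed

text \<open>Moving one level inward replaces \<open>h\<close> by \<open>nb_avg h\<close> at the cost
  of a factor \<open>q\<close>, hence the induction for arbitrary \<open>h\<close>.\<close>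

lemma sum_level_Suc:
  "(\<Sum>u\<in>level (Suc n). h (arc_in u)) = real q ^ n * (\<Sum>u\<in>level 1. (nb_avg ^^ n) h (arc_in u))"
proof (induction n arbitrary: h)
  case (Suc n)
  have "(\<Sum>u\<in>level (Suc (Suc n)). h (arc_in u)) = real q * (\<Sum>v\<in>level (Suc n). nb_avg h (arc_in v))"
    using q_ge_2 by (simp add: sum_level_Suc_Suc nb_avg_def flip: sum_divide_distrib)
  also have "\<dots> = real q ^ Suc n * (\<Sum>u\<in>level 1. (nb_avg ^^ Suc n) h (arc_in u))"
    by (simp add: Suc funpow_swap1)
  finally show ?case .
qed simp

text \<open>The same grouping for the constant 1. The power of \<open>q\<close> is that of
  \<open>sum_level_Suc\<close> and cancels in averages.\<close>

lemma card_level_Suc: "card (level (Suc n)) = q ^ n * card (level 1)"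
proof (induction n)
  case (Suc n)
  have "real (card (level (Suc (Suc n)))) = (\<Sum>v\<in>level (Suc n). real (card (nb_succ (arc_in v))))"
    using sum_level_Suc_Suc[of "\<lambda>_. 1" n] by simp
  also have "\<dots> = (\<Sum>v\<in>level (Suc n). real q)"
    using level_Suc_outside arc_in card_nb_succ by (intro sum.cong) auto
  finally have "card (level (Suc (Suc n))) = q * card (level (Suc n))"
    by (simp flip: of_nat_mult add: mult.commute)
  with Suc show ?case by simp
qed simp

text \<open>A longest path in \<open>X\<close> has a nonbacktracking extension, which leaves
  \<open>X\<close> by maximality.\<close>

lemma level_1_nonempty: "level 1 \<noteq> {}"
proof -
  have "Max (length ` X) \<in> length ` X"
    using finite_X p0 by (intro Max_in) auto
  then obtain x where x: "x \<in> X" "length x = Max (length ` X)" by auto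
  have longest: "length y \<le> length x" if "y \<in> X" for y
    using that x finite_X by simp
  have xW: "x \<in> W" using x X_subset by blast
  \<comment> \<open>If \<open>x\<close> is the root, \<open>arev (last x)\<close> is arbitrary, but
    it still excludes at most one arc.\<close>
  have "card {arev (last x)} < card (out_arcs G (proj x))"
    using regular[OF proj_in_verts[OF xW]] q_ge_2 by (simp add: out_degree_def)
  then have "\<not> out_arcs G (proj x) \<subseteq> {arev (last x)}"
    by (metis card_mono finite.emptyI finite_insert not_le)
  then obtain b where "b \<in> arcs G" "tail G b = proj x" "b \<noteq> arev (last x)"
    by (auto simp: out_arcs_def)
  then have "x @ [b] \<in> W" using xW by (simp add: snoc_in_W_iff)
  moreover have "x @ [b] \<notin> X" using longest[of "x @ [b]"] by auto
  moreover have "\<not> prefix (x @ [b]) p0" using longest[OF p0] prefix_length_le by fastforce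
  ultimately have "x @ [b] \<in> level 1"
    using depth_snoc[of x b] x(1) depth_eq_0_iff[of x] by (simp add: level_def)
  then show ?thesis by blast
qed

section \<open>Tubes are levels\<close>

abbreviation "cover \<equiv> with_proj (universal_cover G arev v0)"

lemma pverts_cover [simp]: "pverts (universal_cover G arev v0) = W"
  by (simp add: universal_cover_def)

lemma wf_cover: "wf_digraph cover"
  by unfold_locales (auto simp: universal_cover_def)

lemma depth_le_awalk: "pre_digraph.awalk cover u p v \<Longrightarrow> depth u \<le> depth v + length p"
proof (induction p arbitrary: u)
  case Nil
  then show ?case by (simp add: wf_digraph.awalk_Nil_iff[OF wf_cover])
next
  case (Cons e p)
  then have e: "e \<in> arcs cover" "fst e = u" and "depth (snd e) \<le> depth v + length p"
    by (auto simp: wf_digraph.awalk_Cons_iff[OF wf_cover])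
  moreover have "depth (fst e) \<le> Suc (depth (snd e))"
    using e depth_lipschitz by (auto simp: universal_cover_def)
  ultimately show ?case by simp
qed

text \<open>Iterating \<open>toward\<close> reaches \<open>X\<close>. Together with
  \<open>depth_le_awalk\<close> this identifies the depth with the distance to
  \<open>X\<close>.\<close>

lemma awalk_to_X:
  "u \<in> W \<Longrightarrow> \<exists>x\<in>X. \<exists>p. pre_digraph.awalk cover u p x \<and> length p = depth u"
proof (induction "depth u" arbitrary: u)
  case 0
  then have "u \<in> X" using depth_eq_0_iff by simp
  moreover have "pre_digraph.awalk cover u [] u"
    using 0 by (simp add: wf_digraph.awalk_Nil_iff[OF wf_cover])
  ultimately show ?case using 0 by force
next
  case (Suc n)
  then have u: "u \<in> W" "u \<notin> X" using depth_eq_0_iff[of u] by auto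
  have n: "n = depth (toward u)" using depth_toward[OF u] Suc by simp
  obtain x p where x: "x \<in> X" "pre_digraph.awalk cover (toward u) p x" "length p = n"
    using Suc(1)[OF n toward_in_W[OF u]] n by auto
  have "\<exists>a. toward u = u @ [a] \<or> u = toward u @ [a]"
    using u by (cases rule: outside_cases) metis+
  then have "(u, toward u) \<in> parcs (universal_cover G arev v0)"
    using u toward_in_W[OF u] by (simp add: universal_cover_def)
  then have "pre_digraph.awalk cover u ((u, toward u) # p) x"
    using x by (simp add: wf_digraph.awalk_Cons_iff[OF wf_cover])
  then show ?case using x Suc(2) by (metis length_Cons)
qed

lemma tube_eq_level:
  assumes verts: "verts T = X"
    and conn: "\<And>x y. x \<in> X \<Longrightarrow> y \<in> X \<Longrightarrow> \<exists>p. pre_digraph.awalk cover x p y"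
  shows "tube cover T r = level r"
proof -
  have "Min ((\<lambda>x. graph_dist cover v x) ` X) = depth v" if v: "v \<in> W" for v
  proof -
    obtain x p where x: "x \<in> X" "pre_digraph.awalk cover v p x" "length p = depth v"
      using awalk_to_X[OF v] by blast
    have ge: "depth v \<le> graph_dist cover v y" if y: "y \<in> X" for y
    proof -
      \<comment> \<open>The \<open>LEAST\<close> in \<open>graph_dist\<close> is attained only if
        some walk to \<open>y\<close> exists; one is built through \<open>x\<close>.\<close>
      obtain p' where "pre_digraph.awalk cover x p' y" using conn x y by blast
      then have "pre_digraph.awalk cover v (p @ p') y"
        using x wf_digraph.awalk_appendI[OF wf_cover] by blast
      then have "\<exists>n p. pre_digraph.awalk cover v p y \<and> length p = n" by blast
      then have "\<exists>p. pre_digraph.awalk cover v p y \<and> length p = graph_dist cover v y"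
        unfolding graph_dist_def by (rule LeastI_ex)
      then obtain p'' where p'': "pre_digraph.awalk cover v p'' y" "length p'' = graph_dist cover v y"
        by blast
      have "depth y = 0" using y depth_eq_0_iff by simp
      then show ?thesis using depth_le_awalk[OF p''(1)] p''(2) by simp
    qed
    have "graph_dist cover v x \<le> depth v"
      unfolding graph_dist_def by (rule Least_le) (use x in blast)
    with ge[OF x(1)] have "depth v = graph_dist cover v x" by simp
    then have "depth v \<in> graph_dist cover v ` X" using x(1) by (rule image_eqI)
    then show ?thesis
      using finite_X ge by (intro Min_eqI) auto
  qed
  then show ?thesis
    using verts by (auto simp: tube_def level_def)
qed

text \<open>The average over \<open>level (Suc n)\<close> is an average of
  \<open>(nb_avg ^^ n) h\<close> over \<open>level 1\<close> and inherits a bound valid at all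
  arcs.\<close>

lemma abs_sum_level_le:
  fixes h :: "'e \<Rightarrow> real" and B :: real
  assumes decay: "\<And>a. a \<in> arcs G \<Longrightarrow> \<bar>(nb_avg ^^ n) h a\<bar> \<le> B"
  shows "\<bar>\<Sum>u\<in>level (Suc n). h (arc_in u)\<bar> \<le> card (level (Suc n)) * B"
proof -
  have "\<bar>\<Sum>u\<in>level 1. (nb_avg ^^ n) h (arc_in u)\<bar> \<le> (\<Sum>u\<in>level 1. \<bar>(nb_avg ^^ n) h (arc_in u)\<bar>)"
    by (rule sum_abs)
  also have "\<dots> \<le> (\<Sum>u\<in>level 1. B)"
  proof (rule sum_mono)
    fix u assume "u \<in> level 1"
    then have "arc_in u \<in> arcs G" using level_Suc_outside[of u 0] arc_in(1)[of u] by simp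
    then show "\<bar>(nb_avg ^^ n) h (arc_in u)\<bar> \<le> B" by (rule decay)
  qed
  finally have "real q ^ n * \<bar>\<Sum>u\<in>level 1. (nb_avg ^^ n) h (arc_in u)\<bar>
      \<le> real q ^ n * (card (level 1) * B)"
    by (intro mult_left_mono) simp_all
  then show ?thesis
    unfolding sum_level_Suc[of h n] card_level_Suc[of n] by (simp add: abs_mult mult.assoc)
qed

end

section \<open>Connected subgraphs of the cover\<close>

lemma (in regular_bidirected_digraph) connected_subgraph_cover_subtree:
  assumes v0: "v0 \<in> verts G"
    and T: "pair_pseudo_graph T"
    and sub: "subgraph (with_proj T) (with_proj (universal_cover G arev v0))"
    and ne: "pverts T \<noteq> {}"
    and conn: "Digraph_Component.connected (with_proj T)"
  obtains p0 where "cover_subtree G arev q v0 (pverts T) p0"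
    and "\<And>x y. x \<in> pverts T \<Longrightarrow> y \<in> pverts T \<Longrightarrow>
      \<exists>p. pre_digraph.awalk (with_proj (universal_cover G arev v0)) x p y"
proof -
  interpret T: pair_pseudo_graph T by (rule T)
  have wf: "wf_digraph (with_proj (universal_cover G arev v0))"
    using sub by (simp add: subgraph_def)
  have T_sub: "pverts T \<subseteq> cover_verts G arev v0"
    "parcs T \<subseteq> parcs (universal_cover G arev v0)"
    using sub by (auto simp: subgraph_def universal_cover_def)
  have "strongly_connected (with_proj T)"
    using T.symmetric_connected_imp_strongly_connected[OF _ conn] T.pair_sym_arcs by simp
  then have reach: "x \<rightarrow>\<^sup>*\<^bsub>with_proj T\<^esub> y" if "x \<in> pverts T" "y \<in> pverts T" for x y
    using that by (auto simp: strongly_connected_def)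
  \<comment> \<open>The top vertex is a shortest path in \<open>T\<close>. A walk in
    \<open>T\<close> from it appends or removes one arc at a time and cannot climb above it, so it
    visits every intermediate prefix.\<close>
  obtain p0 where p0: "p0 \<in> pverts T" "\<And>y. y \<in> pverts T \<Longrightarrow> length p0 \<le> length y"
    using ne ex_has_least_nat[of "\<lambda>x. x \<in> pverts T" _ length] by blast
  have inv: "prefix p0 x \<and> (\<forall>y. prefix p0 y \<longrightarrow> prefix y x \<longrightarrow> y \<in> pverts T)"
    if "x \<in> pverts T" for x
  proof -
    have "(p0, x) \<in> rtrancl_on (pverts T) (parcs T)"
      using reach[OF p0(1) that] by (simp add: reachable_def)
    then show ?thesis
    proof (induction rule: rtrancl_on_induct)
      case base
      then show ?case using p0(1) prefix_order.antisym by blast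
    next
      case (step x x')
      have x': "x' \<in> pverts T" using step T.arc_snd_in_verts by fastforce
      from step T_sub(2) obtain a where "x' = x @ [a] \<or> x = x' @ [a]"
        by (auto simp: universal_cover_def)
      then show ?case
      proof
        assume "x' = x @ [a]"
        then show ?thesis using step x' by auto
      next
        assume x: "x = x' @ [a]"
        \<comment> \<open>A step up from \<open>p0\<close> would reach a vertex of \<open>T\<close>
          shorter than \<open>p0\<close>.\<close>
        then have "p0 \<noteq> x" using p0(2)[OF x'] by auto
        then show ?thesis using step x by auto
      qed
    qed
  qed
  have "cover_subtree G arev q v0 (pverts T) p0"
  proof unfold_locales
    show "finite (pverts T)" by simp
    fix x y assume "x \<in> pverts T"
    then show "prefix p0 x" and "prefix p0 y \<Longrightarrow> prefix y x \<Longrightarrow> y \<in> pverts T"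
      using inv by blast+
  qed (use v0 T_sub p0(1) in simp_all)
  moreover have "\<exists>p. pre_digraph.awalk (with_proj (universal_cover G arev v0)) x p y"
    if xy: "x \<in> pverts T" "y \<in> pverts T" for x y
  proof -
    obtain p where "pre_digraph.awalk (with_proj T) x p y"
      using reach[OF xy] T.reachable_awalk by auto
    then show ?thesis
      using wf_digraph.subgraph_awalk_imp_awalk[OF wf _ sub] by blast
  qed
  ultimately show ?thesis using that by blast
qed

section \<open>Averages over tubes\<close>

theorem corollary5:
  fixes G :: "('v, 'e) pre_digraph" and arev :: "'e \<Rightarrow> 'e" and q :: nat
  assumes "bidirected_digraph G arev"
    and "fin_digraph G"
    and "Digraph_Component.connected G"
    and "\<not> bipartite G"
    and "\<forall>v \<in> verts G. out_degree G v = q + 1"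
    and "q + 1 \<ge> 3"
  shows "\<exists>\<beta>::real. real q powr (-1/2) \<le> \<beta> \<and> \<beta> < 1 \<and>
    (\<forall>v0 \<in> verts G. \<forall>X :: 'e list pair_pre_digraph.
       pair_pseudo_graph X \<and>
       subgraph (with_proj X) (with_proj (universal_cover G arev v0)) \<and>
       pverts X \<noteq> {} \<and> Digraph_Component.connected (with_proj X) \<longrightarrow>
       (\<exists>C::real. C > 0 \<and>
          (\<forall>(f :: 'v \<Rightarrow> real) (r :: nat).
             let T = tube (with_proj (universal_cover G arev v0)) (with_proj X) r in
             \<bar>(1 / real (card T)) * (\<Sum>v\<in>T. lift G v0 f v)
               - (1 / real (card (verts G))) * (\<Sum>v\<in>verts G. f v)\<bar>
             \<le> C * L2_set f (verts G) * \<beta> ^ r)))"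
proof -
  interpret bidirected_digraph G arev by (rule assms)
  interpret fin_digraph G by (rule assms)
  interpret regular_bidirected_digraph G arev q
    by unfold_locales (use assms in auto)
  obtain \<beta> where \<beta>: "real q powr (-1/2) \<le> \<beta>" "\<beta> < 1"
    "\<And>g n a. (\<Sum>a\<in>arcs G. g a) = 0 \<Longrightarrow> a \<in> arcs G \<Longrightarrow>
       \<beta> * \<bar>(nb_avg ^^ n) g a\<bar> \<le> L2_set g (arcs G) * \<beta> ^ n"
    using nb_avg_decay[OF assms(3,4)] by blast
  have "0 < real q powr (-1/2)" using q_ge_2 by simp
  then have \<beta>_pos: "0 < \<beta>" using \<beta>(1) by linarith
  \<comment> \<open>For \<open>r > 0\<close>: \<open>sqrt (q + 1)\<close> comes from passing to
    arcs, one \<beta> from \<open>nb_avg_decay\<close>, the other from \<open>n = r - 1\<close>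
    averaging steps. The 2 covers \<open>r = 0\<close>.\<close>
  define C where "C = sqrt (q + 1) / \<beta>\<^sup>2 + 2"
  have "0 < C" using \<beta>_pos by (simp add: C_def add_nonneg_pos)
  have "\<bar>(1 / real (card T)) * (\<Sum>v\<in>T. lift G v0 f v)
      - (1 / real (card (verts G))) * (\<Sum>v\<in>verts G. f v)\<bar> \<le> C * L2_set f (verts G) * \<beta> ^ r"
    if v0: "v0 \<in> verts G" and X: "pair_pseudo_graph X"
      "subgraph (with_proj X) (with_proj (universal_cover G arev v0))"
      "pverts X \<noteq> {}" "Digraph_Component.connected (with_proj X)"
      and T: "T = tube (with_proj (universal_cover G arev v0)) (with_proj X) r"
    for v0 X f r T
  proof -
    obtain p0 where p0: "cover_subtree G arev q v0 (pverts X) p0"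
      and walks: "\<And>x y. x \<in> pverts X \<Longrightarrow> y \<in> pverts X \<Longrightarrow>
        \<exists>p. pre_digraph.awalk (with_proj (universal_cover G arev v0)) x p y"
      using connected_subgraph_cover_subtree[OF v0 X] by blast
    interpret cover_subtree G arev q v0 "pverts X" p0 by (rule p0)
    have T_eq: "T = level r"
      unfolding T by (rule tube_eq_level[OF _ walks]) simp_all
    have ne: "verts G \<noteq> {}" using v0 by blast
    define m where "m = (\<Sum>v\<in>verts G. f v) / card (verts G)"
    define L where "L = L2_set f (verts G)"
    have L_nonneg: "0 \<le> L" by (simp add: L_def L2_set_nonneg)
    have f_le: "\<bar>f v\<bar> \<le> L" if "v \<in> verts G" for v
      using member_le_L2_set[OF finite_verts that, of "\<lambda>v. \<bar>f v\<bar>"]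
      by (simp add: L_def L2_set_def)
    have "0 < card (level 0)" "0 < card (level 1)"
      using level_1_nonempty X(3) finite_level finite_X by (simp_all add: card_gt_0_iff level_0)
    then have card_pos: "0 < card (level r)"
      using q_ge_2 card_level_Suc[of "r - 1"] by (cases "r = 0") simp_all
    have *: "\<bar>\<Sum>v\<in>level r. f (proj v) - m\<bar> \<le> card (level r) * (C * L * \<beta> ^ r)"
    proof (cases r)
      case 0
      \<comment> \<open>The tube of radius 0 is \<open>X\<close> itself, whose vertices have no arc
        entering from \<open>X\<close>; bounding values and mean by \<open>L\<close>
        suffices.\<close>
      have "\<bar>m\<bar> \<le> (\<Sum>v\<in>verts G. \<bar>f v\<bar>) / card (verts G)"
        unfolding m_def by (simp add: divide_right_mono sum_abs)
      also have "\<dots> \<le> L"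
        using sum_bounded_above[of "verts G" "\<lambda>v. \<bar>f v\<bar>" L] f_le ne
        by (simp add: divide_le_eq card_gt_0_iff mult.commute)
      finally have m_le: "\<bar>m\<bar> \<le> L" .
      have "\<bar>\<Sum>v\<in>level r. f (proj v) - m\<bar> \<le> (\<Sum>v\<in>level r. \<bar>f (proj v) - m\<bar>)"
        by (rule sum_abs)
      also have "\<dots> \<le> (\<Sum>v\<in>level r. 2 * L)"
      proof (rule sum_mono)
        fix v assume "v \<in> level r"
        then have "\<bar>f (proj v)\<bar> \<le> L" by (intro f_le proj_in_verts) (simp add: level_def)
        with m_le show "\<bar>f (proj v) - m\<bar> \<le> 2 * L" by linarith
      qed
      also have "\<dots> \<le> card (level r) * (C * L * \<beta> ^ r)"
        using L_nonneg \<beta>_pos 0 by (simp add: C_def mult_left_mono mult_right_mono)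
      finally show ?thesis .
    next
      case (Suc n)
      define g where "g a = f (head G a) - m" for a
      have mean: "(\<Sum>a\<in>arcs G. g a) = 0"
        using sum_head_arcs_mean_0[OF ne] by (simp add: g_def m_def)
      have g_le: "L2_set g (arcs G) \<le> sqrt (q + 1) * L"
        using L2_set_head_arcs_le[OF ne] by (simp add: g_def[abs_def] m_def L_def)
      have decay: "\<bar>(nb_avg ^^ n) g a\<bar> \<le> sqrt (q + 1) * L * \<beta> ^ n / \<beta>"
        if "a \<in> arcs G" for a n
      proof -
        have "\<beta> * \<bar>(nb_avg ^^ n) g a\<bar> \<le> sqrt (q + 1) * L * \<beta> ^ n"
          using \<beta>(3)[OF mean that, of n]
          by (rule order.trans) (intro mult_right_mono g_le, use \<beta>_pos in simp)
        then show ?thesis using \<beta>_pos by (simp add: le_divide_eq mult.commute)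
      qed
      \<comment> \<open>The projection of \<open>v\<close> is the head of \<open>arc_in v\<close>,
        which makes the sum one of arc values.\<close>
      have "(\<Sum>v\<in>level r. f (proj v) - m) = (\<Sum>v\<in>level (Suc n). g (arc_in v))"
        using level_Suc_outside[of _ n] arc_in(2) by (simp add: Suc g_def)
      also have "\<bar>\<dots>\<bar> \<le> card (level (Suc n)) * (sqrt (q + 1) * L * \<beta> ^ n / \<beta>)"
        by (rule abs_sum_level_le[OF decay])
      also have "sqrt (q + 1) * L * \<beta> ^ n / \<beta> = sqrt (q + 1) / \<beta>\<^sup>2 * L * \<beta> ^ r"
        using \<beta>_pos Suc by (simp add: field_simps power2_eq_square)
      also have "\<dots> \<le> C * L * \<beta> ^ r"
        using L_nonneg \<beta>_pos by (intro mult_right_mono) (auto simp: C_def)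
      finally show ?thesis using Suc by (simp add: mult_left_mono)
    qed
    have "(1 / real (card T)) * (\<Sum>v\<in>T. lift G v0 f v) - (1 / real (card (verts G))) * (\<Sum>v\<in>verts G. f v)
        = (\<Sum>v\<in>level r. f (proj v) - m) / card (level r)"
      using card_pos by (simp add: T_eq lift_def m_def sum_subtractf field_simps)
    then show ?thesis
      using * card_pos by (simp add: L_def divide_le_eq mult.commute)
  qed
  with \<open>0 < C\<close> have "\<exists>C>0. \<forall>f r. let T = tube (with_proj (universal_cover G arev v0)) (with_proj X) r in
      \<bar>(1 / real (card T)) * (\<Sum>v\<in>T. lift G v0 f v)
        - (1 / real (card (verts G))) * (\<Sum>v\<in>verts G. f v)\<bar> \<le> C * L2_set f (verts G) * \<beta> ^ r"
    if "v0 \<in> verts G" "pair_pseudo_graph X"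
      "subgraph (with_proj X) (with_proj (universal_cover G arev v0))"
      "pverts X \<noteq> {}" "Digraph_Component.connected (with_proj X)"
    for v0 X
    using that unfolding Let_def by (intro exI[of _ C] conjI allI) simp_all
  with \<beta>(1,2) show ?thesis
    by - (rule exI[of _ \<beta>], intro conjI ballI allI impI, simp_all)
qed

end
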